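(* Let $\hat\gamma:2\pi\mathbb{T}\to(0,\infty)$ be of class $C^2$ and satisfy $3\hat\gamma(\theta)-\hat\gamma(\theta-\pi)\ge 0$ for all $\theta\in 2\pi\mathbb{T}$. Then the fully discrete scheme (SP) described in the context is area conservative and, for sufficiently large stabilizing function $k$, unconditionally energy dissipative. That is, there is a function $K:2\pi\mathbb{T}\to[0,\infty)$ depending only on $\hat\gamma$ such that for every $k:2\pi\mathbb{T}\to\mathbb{R}_{\ge 0}$ with $k(\theta)\ge K(\theta)$ for all $\theta$, every integer $N>2$, every time step $\tau>0$, and every sequence $(\boldsymbol X^{m})_{m\ge 0}$, $(\mu^{m})_{m\ge 1}$ solving (SP) for all $m\ge0$ (with all segments nondegenerate), $$A_c^{m+1}=A_c^m=\cdots=A_c^0,\qquad W_c^{m+1}\le W_c^m\le\cdots\le W_c^0,\qquad \forall m\ge 0.$$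
   Context: $2\pi\mathbb{T}=\mathbb{R}/2\pi\mathbb{Z}$; functions on it are $2\pi$-periodic functions on $\mathbb{R}$. Surface energy matrix: for $k:2\pi\mathbb{T}\to\mathbb{R}_{\ge0}$, $$\hat{\boldsymbol Z}_k(\theta)=\begin{pmatrix}\hat\gamma(\theta)-\hat\gamma'(\theta)\sin2\theta&\hat\gamma'(\theta)\cos2\theta\\ \hat\gamma'(\theta)\cos2\theta&\hat\gamma(\theta)+\hat\gamma'(\theta)\sin2\theta\end{pmatrix}+k(\theta)\begin{pmatrix}\sin^2\theta&-\cos\theta\sin\theta\\-\cos\theta\sin\theta&\cos^2\theta\end{pmatrix}.$$ Mesh and spaces: $N>2$ is an integer, $h=1/N$, $\rho_j=jh$ ($0\le j\le N$), $I_j=[\rho_{j-1},\rho_j]$ ($1\le j\le N$). $\mathbb{K}^h_p$ is the space of continuous functions $u$ on $[0,1]$ that are affine on each $I_j$ and satisfy $u(0)=u(1)$. Discrete curves: $\boldsymbol X^m=(x^m,y^m)^T\in[\mathbb{K}^h_p]^2$, $m=0,1,2,\dots$, represents a closed polygonal curve $\Gamma^m$ with segments $\boldsymbol h^m_j=\boldsymbol X^m(\rho_j)-\boldsymbol X^m(\rho_{j-1})$, $1\le j\le N$, assumed nonzero. The angle $\theta^m$ is constant on each $I_j$ with value $\theta_j^m\in 2\pi\mathbb{T}$ determined by $\boldsymbol h^m_j=|\boldsymbol h^m_j|(\cos\theta^m_j,\sin\theta^m_j)^T$. On $\Gamma^m$: $\partial_s f|_{I_j}=\dfrac{f(\rho_j)-f(\rho_{j-1})}{|\boldsymbol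 h_j^m|}$ for $1\le j\le N$, and $$\bigl(f,g\bigr)^h_{\Gamma^m}=\sum_{j=1}^N\frac{|\boldsymbol h^m_j|}{2}\bigl(f(\rho_j)\cdot g(\rho_j)+f(\rho_{j-1})\cdot g(\rho_{j-1})\bigr),$$ where for functions discontinuous at nodes the values in the $j$-th summand are the one-sided limits from inside $I_j$ (and $\cdot$ is the Euclidean product for vector-valued functions). Put $(a,b)^\perp=(b,-a)$ and $\boldsymbol n^{m+\frac12}=-\tfrac12(\partial_s\boldsymbol X^m+\partial_s\boldsymbol X^{m+1})^\perp$, with $\partial_s$ taken on $\Gamma^m$; i.e. $\boldsymbol n^{m+\frac12}|_{I_j}=-\frac{1}{2|\boldsymbol h^m_j|}(\boldsymbol h^m_j+\boldsymbol h^{m+1}_j)^\perp$. Scheme (SP) with time step $\tau>0$: given $\boldsymbol X^0\in[\mathbb{K}^h_p]^2$, for $m=0,1,2,\dots$ find $(\boldsymbol X^{m+1},\mu^{m+1})\in[\mathbb{K}^h_p]^2\times\mathbb{K}^h_p$ such that $$\Bigl(\boldsymbol n^{m+\frac12}\cdot\frac{\boldsymbol X^{m+1}-\boldsymbol X^m}{\tau},\varphi^h\Bigr)^h_{\Gamma^m}+\Bigl(\partial_s\mu^{m+1},\partial_s\varphi^h\Bigr)^h_{\Gamma^m}=0\quad\forall\varphi^h\in\mathbb{K}^h_p,$$ $$\Bigl(\mu^{m+1}\boldsymbol n^{m+\frac12},\boldsymbol\omega^h\Bigr)^h_{\Gamma^m}-\Bigl(\hat{\boldsymbol Z}_k(\theta^m)\partial_s\boldsymbol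 X^{m+1},\partial_s\boldsymbol\omega^h\Bigr)^h_{\Gamma^m}=0\quad\forall\boldsymbol\omega^h\in[\mathbb{K}^h_p]^2.$$ Discrete area and energy, with $x^m_j=x^m(\rho_j)$, $y_j^m=y^m(\rho_j)$: $$A_c^m=\frac12\sum_{j=1}^N(x^m_j-x^m_{j-1})(y^m_j+y^m_{j-1}),\qquad W_c^m=\sum_{j=1}^N\hat\gamma(\theta^m_j)|\boldsymbol h^m_j|.$$ *)

theory Defs
  imports "HOL-Analysis.Analysis" "HOL-Library.Periodic_Fun"
begin

text \<open>
  Functions on $2\pi\mathbb{T} = \mathbb{R}/2\pi\mathbb{Z}$ are functions \<open>f :: real \<Rightarrow> _\<close> with
  \<open>periodic_fun_simple f (2 * pi)\<close>.
\<close>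

definition C2_fun :: "(real \<Rightarrow> real) \<Rightarrow> bool" where
  "C2_fun f \<longleftrightarrow>
     (\<forall>x. f differentiable (at x)) \<and>
     (\<forall>x. deriv f differentiable (at x)) \<and>
     continuous_on UNIV (deriv (deriv f))"

definition Z_mat :: "(real \<Rightarrow> real) \<Rightarrow> (real \<Rightarrow> real) \<Rightarrow> real \<Rightarrow> real^2^2" where
  "Z_mat \<gamma> k \<theta> =
     vector [vector [\<gamma> \<theta> - deriv \<gamma> \<theta> * sin (2 * \<theta>), deriv \<gamma> \<theta> * cos (2 * \<theta>)],
             vector [deriv \<gamma> \<theta> * cos (2 * \<theta>), \<gamma> \<theta> + deriv \<gamma> \<theta> * sin (2 * \<theta>)]]
     + k \<theta> *\<^sub>R
     vector [vector [(sin \<theta>)\<^sup>2, - (cos \<theta> * sin \<theta>)],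
             vector [- (cos \<theta> * sin \<theta>), (cos \<theta>)\<^sup>2]]"


subsection \<open>Mesh and finite element spaces\<close>

definition node :: "nat \<Rightarrow> nat \<Rightarrow> real" where
  "node N j = real j / real N"

definition fe_space :: "nat \<Rightarrow> (real \<Rightarrow> real) set" where
  "fe_space N = {u. continuous_on {0..1} u \<and>
     (\<forall>j\<in>{1..N}. \<exists>a b. \<forall>\<rho>\<in>{node N (j - 1)..node N j}. u \<rho> = a + b * \<rho>) \<and>
     u 0 = u 1}"

definition fe_space2 :: "nat \<Rightarrow> (real \<Rightarrow> real^2) set" where
  "fe_space2 N = {u. \<forall>i. (\<lambda>\<rho>. u \<rho> $ i) \<in> fe_space N}"

text \<open>
  \<open>elem_idx N \<rho>\<close> is the \<open>j\<close> with \<open>node N (j - 1) < \<rho> \<le> node N j\<close>.  Functions that are constant on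
  each element are represented through it; the value this selects at a node is immaterial, since
  such functions are evaluated only through the one-sided limits in \<open>lumped\<close>.
\<close>

definition elem_idx :: "nat \<Rightarrow> real \<Rightarrow> nat" where
  "elem_idx N \<rho> = nat \<lceil>\<rho> * real N\<rceil>"


subsection \<open>Quantities on a polygonal curve\<close>

definition seg :: "nat \<Rightarrow> (real \<Rightarrow> real^2) \<Rightarrow> nat \<Rightarrow> real^2" where
  "seg N X j = X (node N j) - X (node N (j - 1))"

text \<open>
  A real representative of the direction angle in $\mathbb{R}/2\pi\mathbb{Z}$, which is unique for
  \<open>v \<noteq> 0\<close>.  Which representative is chosen does not matter, as the angle is only ever passed to
  \<open>2 * pi\<close>-periodic functions.
\<close>

definition dir_angle :: "real^2 \<Rightarrow> real" where
  "dir_angle v = (SOME \<theta>. v = norm v *\<^sub>R vector [cos \<theta>, sin \<theta>])"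

definition curve_angle :: "nat \<Rightarrow> (real \<Rightarrow> real^2) \<Rightarrow> real \<Rightarrow> real" where
  "curve_angle N X \<rho> = dir_angle (seg N X (elem_idx N \<rho>))"

definition arc_deriv ::
    "nat \<Rightarrow> (real \<Rightarrow> real^2) \<Rightarrow> (real \<Rightarrow> 'a::real_vector) \<Rightarrow> real \<Rightarrow> 'a" where
  "arc_deriv N X f \<rho> =
     (let j = elem_idx N \<rho> in (f (node N j) - f (node N (j - 1))) /\<^sub>R norm (seg N X j))"

text \<open>
  For functions that are continuous on each element, up to jumps at the nodes, all the limits
  below exist; for functions continuous on \<open>{0..1}\<close> they are the nodal values.
\<close>

definition lumped ::
    "nat \<Rightarrow> (real \<Rightarrow> real^2) \<Rightarrow> (real \<Rightarrow> 'a::real_inner) \<Rightarrow> (real \<Rightarrow> 'a) \<Rightarrow> real" where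
  "lumped N X f g =
     (\<Sum>j=1..N. norm (seg N X j) / 2 *
        (Lim (at_left (node N j)) f \<bullet> Lim (at_left (node N j)) g +
         Lim (at_right (node N (j - 1))) f \<bullet> Lim (at_right (node N (j - 1))) g))"

definition perp :: "real^2 \<Rightarrow> real^2" where
  "perp v = vector [v $ 2, - (v $ 1)]"

text \<open>In \<open>half_normal N X X'\<close> both derivatives are taken along the old curve \<open>X\<close>.\<close>

definition half_normal ::
    "nat \<Rightarrow> (real \<Rightarrow> real^2) \<Rightarrow> (real \<Rightarrow> real^2) \<Rightarrow> real \<Rightarrow> real^2" where
  "half_normal N X X' \<rho> = - ((1 / 2) *\<^sub>R perp (arc_deriv N X X \<rho> + arc_deriv N X X' \<rho>))"

definition area :: "nat \<Rightarrow> (real \<Rightarrow> real^2) \<Rightarrow> real" where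
  "area N X = 1 / 2 *
     (\<Sum>j=1..N. (X (node N j) $ 1 - X (node N (j - 1)) $ 1) *
                (X (node N j) $ 2 + X (node N (j - 1)) $ 2))"

definition energy :: "(real \<Rightarrow> real) \<Rightarrow> nat \<Rightarrow> (real \<Rightarrow> real^2) \<Rightarrow> real" where
  "energy \<gamma> N X = (\<Sum>j=1..N. \<gamma> (dir_angle (seg N X j)) * norm (seg N X j))"


subsection \<open>The fully discrete scheme\<close>

definition SP_step ::
    "(real \<Rightarrow> real) \<Rightarrow> (real \<Rightarrow> real) \<Rightarrow> nat \<Rightarrow> real \<Rightarrow>
     (real \<Rightarrow> real^2) \<Rightarrow> (real \<Rightarrow> real^2) \<Rightarrow> (real \<Rightarrow> real) \<Rightarrow> bool" where
  "SP_step \<gamma> k N \<tau> X X' \<mu> \<longleftrightarrow>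
     (\<forall>\<phi>\<in>fe_space N.
        lumped N X (\<lambda>\<rho>. half_normal N X X' \<rho> \<bullet> ((X' \<rho> - X \<rho>) /\<^sub>R \<tau>)) \<phi>
        + lumped N X (arc_deriv N X \<mu>) (arc_deriv N X \<phi>) = 0) \<and>
     (\<forall>\<omega>\<in>fe_space2 N.
        lumped N X (\<lambda>\<rho>. \<mu> \<rho> *\<^sub>R half_normal N X X' \<rho>) \<omega>
        - lumped N X (\<lambda>\<rho>. Z_mat \<gamma> k (curve_angle N X \<rho>) *v arc_deriv N X X' \<rho>)
            (arc_deriv N X \<omega>) = 0)"

text \<open>The scheme involves only \<open>\<mu> m\<close> with \<open>m \<ge> 1\<close>; the value \<open>\<mu> 0\<close> is unconstrained.\<close>

definition solves_SP ::
    "(real \<Rightarrow> real) \<Rightarrow> (real \<Rightarrow> real) \<Rightarrow> nat \<Rightarrow> real \<Rightarrow>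
     (nat \<Rightarrow> real \<Rightarrow> real^2) \<Rightarrow> (nat \<Rightarrow> real \<Rightarrow> real) \<Rightarrow> bool" where
  "solves_SP \<gamma> k N \<tau> X \<mu> \<longleftrightarrow>
     X 0 \<in> fe_space2 N \<and>
     (\<forall>m. X (Suc m) \<in> fe_space2 N \<and> \<mu> (Suc m) \<in> fe_space N \<and>
          SP_step \<gamma> k N \<tau> (X m) (X (Suc m)) (\<mu> (Suc m)))"

end

theory Submission
  imports Defs
begin

text \<open>
  Testing the first equation with \<open>\<phi> = 1\<close> removes the chemical potential and leaves the lumped flux
  of the displacement through the averaged normal.  Since that normal averages the old and the new
  segment, the flux is exactly the increment of the shoelace area, up to a telescoping sum over
  the closed polygon (\<open>area_difference\<close>).

  Testing with \<open>\<phi> = \<mu>\<close> in the first and \<open>\<omega> = X' - X\<close> in the second equation and eliminating the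
  common term \<open>(\<mu> n, X' - X)\<close> gives
  \[ \sum_j \frac{(Z_k(\theta_j) h'_j) \cdot (h'_j - h_j)}{|h_j|}
     = - \tau (\partial_s \mu, \partial_s \mu) \le 0, \]
  where \<open>h\<close> and \<open>h'\<close> are the old and new segments.  So it is enough that each summand dominates the
  energy increment \<open>\<gamma>(\<theta>') |h'| - \<gamma>(\<theta>) |h|\<close> of its own segment (\<open>segment_energy_estimate\<close>).

  Write \<open>d\<close> for the turning angle \<open>\<theta>' - \<theta>\<close> and \<open>r = |h'| / |h|\<close>.  Divided by \<open>|h|\<close>, the required
  inequality reads \<open>p r\<^sup>2 - Q r + \<gamma>(\<theta>) \<ge> 0\<close> with
  \[ p = \gamma(\theta) + \gamma'(\theta) \sin 2d + k(\theta) \sin^2 d, \qquad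
     Q = \gamma(\theta) \cos d + \gamma'(\theta) \sin d + \gamma(\theta + d), \]
  which holds for all \<open>r\<close> as soon as the discriminant \<open>Q\<^sup>2 - 4 \<gamma>(\<theta>) p\<close> is not positive.  A large
  \<open>k(\<theta>)\<close> achieves this away from the zeros of \<open>sin d\<close>.  At these zeros the negative discriminant
  with \<open>k = 0\<close>, a function \<open>F\<close> of \<open>d\<close>, must be nonnegative and vanish to second order if it
  vanishes.  At \<open>d = 0\<close> it does so identically.  At \<open>d = \<pi>\<close> one has
  \<open>F = (3 \<gamma>(\<theta>) - \<gamma>(\<theta> - \<pi>)) (\<gamma>(\<theta>) + \<gamma>(\<theta> - \<pi>))\<close>; this is where the hypothesis enters, and if it
  holds with equality at \<open>\<theta>\<close>, then \<open>\<theta>\<close> minimizes \<open>3 \<gamma>(\<theta>) - \<gamma>(\<theta> - \<pi>)\<close>, so that the derivatives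
  cancel as well (\<open>stabilizes_exists\<close>).
\<close>

section \<open>The stabilizing function\<close>

text \<open>
  The condition says that the quadratic \<open>p r\<^sup>2 - Q r + \<gamma> \<theta>\<close> in the length ratio \<open>r\<close> of the new to
  the old segment has nonpositive discriminant for every turning angle \<open>d\<close>.
\<close>


definition stabilizes :: "(real \<Rightarrow> real) \<Rightarrow> real \<Rightarrow> real \<Rightarrow> bool" where
  "stabilizes \<gamma> \<theta> \<kappa> \<longleftrightarrow> 0 \<le> \<kappa> \<and>
     (\<forall>d. (\<gamma> \<theta> * cos d + deriv \<gamma> \<theta> * sin d + \<gamma> (\<theta> + d))\<^sup>2
          \<le> 4 * \<gamma> \<theta> * (\<gamma> \<theta> + deriv \<gamma> \<theta> * sin (2 * d) + \<kappa> * (sin d)\<^sup>2))"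

text \<open>
  A substitute for Taylor's formula: where \<open>F\<close> is positive, continuity suffices; at a critical zero,
  \<open>F'\<close> grows at most linearly, and the mean value inequality integrates this bound.
\<close>

lemma quadratic_lower_bound_near:
  fixes F F' :: "real \<Rightarrow> real"
  assumes F: "\<And>x. (F has_real_derivative F' x) (at x)"
    and F': "F' differentiable (at a)"
    and nonneg: "0 \<le> F a" and crit: "F a = 0 \<Longrightarrow> F' a = 0"
  obtains C where "0 \<le> C" "\<forall>\<^sub>F x in nhds a. - C * (x - a)\<^sup>2 \<le> F x"
proof (cases "F a = 0")
  case False
  have "(F \<longlongrightarrow> F a) (nhds a)"
    using DERIV_isCont[OF F] by (simp add: tendsto_nhds_iff isCont_def)
  then have "\<forall>\<^sub>F x in nhds a. 0 < F x"
    using False nonneg by (intro order_tendstoD(1)) auto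
  then have "\<forall>\<^sub>F x in nhds a. - 0 * (x - a)\<^sup>2 \<le> F x"
    by eventually_elim simp
  then show ?thesis using that[of 0] by simp
next
  case True
  obtain D where "(F' has_real_derivative D) (at a)"
    using F' by (auto simp: real_differentiable_def)
  then have "((\<lambda>x. F' x / (x - a)) \<longlongrightarrow> D) (at a)"
    using crit[OF True] by (simp add: has_field_derivative_iff)
  then have "\<forall>\<^sub>F x in at a. dist (F' x / (x - a)) D < 1"
    by (rule tendstoD) simp
  then obtain e where e: "0 < e" "\<And>x. x \<noteq> a \<Longrightarrow> dist x a < e \<Longrightarrow> dist (F' x / (x - a)) D < 1"
    by (auto simp: eventually_at)
  define C where "C = \<bar>D\<bar> + 1"
  have bound: "\<bar>F' x\<bar> \<le> C * \<bar>x - a\<bar>" if "dist x a < e" for x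
  proof (cases "x = a")
    case False
    then have "\<bar>F' x / (x - a)\<bar> \<le> C"
      using e(2)[OF False that] unfolding C_def dist_real_def by linarith
    then show ?thesis using False by (simp add: abs_divide field_simps)
  qed (use crit[OF True] in simp)
  have "- C * (x - a)\<^sup>2 \<le> F x" if x: "dist x a < e" for x
  proof -
    have "norm (F x - F a) \<le> (C * \<bar>x - a\<bar>) * norm (x - a)"
    proof (rule field_differentiable_bound[where S = "closed_segment a x" and f' = F'])
      fix z assume "z \<in> closed_segment a x"
      then have z: "\<bar>z - a\<bar> \<le> \<bar>x - a\<bar>"
        using segment_bound(1)[of z a x] by simp
      then have "\<bar>F' z\<bar> \<le> C * \<bar>z - a\<bar>" using x by (intro bound) (simp add: dist_real_def)
      also have "\<dots> \<le> C * \<bar>x - a\<bar>" using z by (intro mult_left_mono) (auto simp: C_def)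
      finally show "norm (F' z) \<le> C * \<bar>x - a\<bar>" by simp
    qed (use F in \<open>auto intro: has_field_derivative_at_within\<close>)
    then show ?thesis using True by (simp add: power2_eq_square abs_mult[symmetric] mult.assoc)
  qed
  then have "\<forall>\<^sub>F x in nhds a. - C * (x - a)\<^sup>2 \<le> F x"
    using e(1) by (auto simp: eventually_nhds_metric)
  then show ?thesis using that[of C] by (simp add: C_def)
qed

lemma sin_squared_lower_bound_near_zero:
  fixes a :: real
  assumes "sin a = 0"
  shows "\<forall>\<^sub>F x in nhds a. (x - a)\<^sup>2 \<le> 4 * (sin x)\<^sup>2"
proof -
  have "((\<lambda>x. sin x / (x - a)) \<longlongrightarrow> cos a) (at a)"
    using DERIV_sin[of a] assms by (simp add: has_field_derivative_iff)
  then have "((\<lambda>x. (sin x / (x - a))\<^sup>2) \<longlongrightarrow> 1) (at a)"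
    using tendsto_power[of _ "cos a" "at a" 2] assms sin_cos_squared_add[of a] by fastforce
  then have "\<forall>\<^sub>F x in at a. 1 / 4 < (sin x / (x - a))\<^sup>2"
    by (rule order_tendstoD) simp
  then have "\<forall>\<^sub>F x in at a. (x - a)\<^sup>2 \<le> 4 * (sin x)\<^sup>2"
    using eventually_neq_at_within[of a a UNIV]
    by eventually_elim (simp add: power_divide field_simps)
  then show ?thesis using assms by (auto simp: eventually_nhds_conv_at)
qed

text \<open>
  Near each point some multiple of \<open>sin\<^sup>2\<close> works: at a zero of \<open>sin\<close>, because \<open>sin\<^sup>2\<close> is comparable
  to the squared distance, and elsewhere because \<open>sin\<^sup>2\<close> is bounded away from zero.  Compactness of
  the interval makes the constant uniform.
\<close>

lemma lower_bound_by_sin_squared: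
  fixes F F' :: "real \<Rightarrow> real"
  assumes F: "\<And>x. (F has_real_derivative F' x) (at x)"
    and F': "\<And>x. F' differentiable (at x)"
    and nonneg: "\<And>a. sin a = 0 \<Longrightarrow> 0 \<le> F a"
    and crit: "\<And>a. sin a = 0 \<Longrightarrow> F a = 0 \<Longrightarrow> F' a = 0"
    and "l \<le> u"
  shows "\<exists>C\<ge>0. \<forall>x\<in>{l..u}. - C * (sin x)\<^sup>2 \<le> F x"
proof -
  have near: "\<exists>C\<ge>0. \<forall>\<^sub>F x in nhds a. - C * (sin x)\<^sup>2 \<le> F x" for a
  proof (cases "sin a = 0")
    case True
    obtain C where C: "0 \<le> C" "\<forall>\<^sub>F x in nhds a. - C * (x - a)\<^sup>2 \<le> F x"
      using quadratic_lower_bound_near[OF F F' nonneg[OF True] crit[OF True]] by blast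
    have "\<forall>\<^sub>F x in nhds a. - (4 * C) * (sin x)\<^sup>2 \<le> F x"
      using C(2) sin_squared_lower_bound_near_zero[OF True]
    proof eventually_elim
      case (elim x)
      then show ?case using mult_left_mono[OF elim(2) C(1)] by simp
    qed
    then show ?thesis using C(1) by (intro exI[of _ "4 * C"]) simp
  next
    case False
    \<comment> \<open>This choice gives \<open>C * (sin a)\<^sup>2 = 2 * (\<bar>F a\<bar> + 1)\<close>, more than enough for a strict inequality at \<open>a\<close>.\<close>
    define C where "C = (\<bar>F a\<bar> + 1) / ((sin a)\<^sup>2 / 2)"
    have C: "0 \<le> C" by (simp add: C_def)
    have lim: "((\<lambda>x. F x + C * (sin x)\<^sup>2) \<longlongrightarrow> F a + C * (sin a)\<^sup>2) (nhds a)"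
      using DERIV_isCont[OF F, of a]
      by (auto simp: tendsto_nhds_iff isCont_def intro!: tendsto_intros)
    have "F a + C * (sin a)\<^sup>2 > 0"
      using False by (simp add: C_def)
    from order_tendstoD(1)[OF lim this]
    have "\<forall>\<^sub>F x in nhds a. - C * (sin x)\<^sup>2 \<le> F x"
      by eventually_elim simp
    then show ?thesis using C by blast
  qed
  show ?thesis
    using \<open>l \<le> u\<close>
  proof (induction rule: Bolzano)
    case (trans a b c)
    then obtain C D where CD: "0 \<le> C" "\<forall>x\<in>{a..b}. - C * (sin x)\<^sup>2 \<le> F x"
      "\<forall>x\<in>{b..c}. - D * (sin x)\<^sup>2 \<le> F x" by blast
    have "- max C D * (sin x)\<^sup>2 \<le> F x" if "x \<in> {a..c}" for x
    proof -
      have "- max C D * (sin x)\<^sup>2 \<le> - C * (sin x)\<^sup>2" "- max C D * (sin x)\<^sup>2 \<le> - D * (sin x)\<^sup>2"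
        by (intro mult_right_mono; simp)+
      moreover have "x \<in> {a..b} \<or> x \<in> {b..c}" using that by auto
      ultimately show ?thesis using CD by (meson order_trans)
    qed
    then show ?case using CD(1) by (intro exI[of _ "max C D"]) auto
  next
    case (local x)
    obtain C e where C: "0 \<le> C" "0 < e" "\<And>y. dist y x < e \<Longrightarrow> - C * (sin y)\<^sup>2 \<le> F y"
      using near[of x] by (auto simp: eventually_nhds_metric)
    show ?case
    proof (rule exI[of _ e], intro conjI allI impI)
      fix a b assume ab: "a \<le> x \<and> x \<le> b \<and> b - a < e"
      have "- C * (sin y)\<^sup>2 \<le> F y" if "y \<in> {a..b}" for y
        using that ab by (intro C(3)) (auto simp: dist_real_def)
      then show "\<exists>C\<ge>0. \<forall>x\<in>{a..b}. - C * (sin x)\<^sup>2 \<le> F x"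
        using C(1) by blast
    qed (use C in auto)
  qed
qed

lemma periodic_deriv:
  fixes f :: "real \<Rightarrow> real"
  assumes "periodic_fun_simple f p"
  shows "periodic_fun_simple (deriv f) p"
proof
  fix x
  interpret periodic_fun_simple f p by fact
  have "(\<lambda>y. f (y + p)) = f" by (simp add: plus_period)
  then have "(f has_real_derivative D) (at (x + p)) \<longleftrightarrow> (f has_real_derivative D) (at x)" for D
    using DERIV_shift[of f D x p] by simp
  then show "deriv f (x + p) = deriv f x"
    by (simp add: deriv_def)
qed

text \<open>
  The function \<open>F\<close> below is the negative discriminant for \<open>\<kappa> = 0\<close>; adding \<open>\<kappa>\<close> contributes
  \<open>4 * \<gamma> \<theta> * \<kappa> * (sin d)\<^sup>2\<close>, so the claim is a lower bound of \<open>F\<close> by a multiple of \<open>sin\<^sup>2\<close>.  The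
  angles with \<open>sin a = 0\<close> split into the unturned segment (\<open>cos a = 1\<close>) and the reversed segment
  (\<open>cos a = -1\<close>).
\<close>

lemma stabilizes_exists:
  fixes \<gamma> :: "real \<Rightarrow> real"
  assumes per: "periodic_fun_simple \<gamma> (2 * pi)"
    and pos: "\<And>\<theta>. 0 < \<gamma> \<theta>"
    and C2: "C2_fun \<gamma>"
    and three: "\<And>\<theta>. 0 \<le> 3 * \<gamma> \<theta> - \<gamma> (\<theta> - pi)"
  shows "\<exists>\<kappa>. stabilizes \<gamma> \<theta> \<kappa>"
proof -
  interpret g: periodic_fun_simple \<gamma> "2 * pi" by fact
  interpret g': periodic_fun_simple "deriv \<gamma>" "2 * pi" by (rule periodic_deriv[OF per])
  have dg: "(\<gamma> has_real_derivative deriv \<gamma> x) (at x)" for x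
    using C2 by (simp add: C2_fun_def DERIV_deriv_iff_real_differentiable)
  have dg': "(deriv \<gamma> has_real_derivative deriv (deriv \<gamma>) x) (at x)" for x
    using C2 by (simp add: C2_fun_def DERIV_deriv_iff_real_differentiable)
  have dgs: "((\<lambda>d. \<gamma> (\<theta> + d)) has_real_derivative deriv \<gamma> (\<theta> + d)) (at d)" for d
    using dg[of "\<theta> + d"] DERIV_shift[of \<gamma> _ d \<theta>] by (simp add: add.commute)
  have dgs': "((\<lambda>d. deriv \<gamma> (\<theta> + d)) has_real_derivative deriv (deriv \<gamma>) (\<theta> + d)) (at d)" for d
    using dg'[of "\<theta> + d"] DERIV_shift[of "deriv \<gamma>" _ d \<theta>] by (simp add: add.commute)
  define g0 where "g0 = \<gamma> \<theta>"
  define g1 where "g1 = deriv \<gamma> \<theta>"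
  define Q where "Q = (\<lambda>d. g0 * cos d + g1 * sin d + \<gamma> (\<theta> + d))"
  define Q' where "Q' = (\<lambda>d. - g0 * sin d + g1 * cos d + deriv \<gamma> (\<theta> + d))"
  define F where "F = (\<lambda>d. 4 * g0 * (g0 + g1 * sin (2 * d)) - (Q d)\<^sup>2)"
  define F' where "F' = (\<lambda>d. 8 * g0 * g1 * cos (2 * d) - 2 * Q d * Q' d)"
  have g0: "0 < g0" by (simp add: g0_def pos)
  have dQ: "(Q has_real_derivative Q' d) (at d)" for d
    unfolding Q_def Q'_def by (auto intro!: derivative_eq_intros dgs)
  have dF: "(F has_real_derivative F' d) (at d)" for d
    unfolding F_def F'_def by (auto intro!: derivative_eq_intros dQ)
  have dF': "F' differentiable (at d)" for d
  proof -
    have "\<exists>D. (Q' has_real_derivative D) (at d)"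
      unfolding Q'_def by (rule exI, (rule derivative_intros dgs')+)
    then have Q: "Q' differentiable (at d)" "Q differentiable (at d)"
      using dQ by (auto simp: real_differentiable_def)
    have "(\<lambda>d. 8 * g0 * g1 * cos (2 * d)) differentiable (at d)"
      unfolding real_differentiable_def by (rule exI, (rule derivative_intros)+)
    then show ?thesis unfolding F'_def
      by (rule differentiable_diff)
        (rule differentiable_mult[OF differentiable_mult[OF differentiable_const Q(2)] Q(1)])
  qed
  have zero: "0 \<le> F a \<and> (F a = 0 \<longrightarrow> F' a = 0)" if sin: "sin a = 0" for a
  proof -
    have s2: "sin (2 * a) = 0" "cos (2 * a) = 1" using sin by (simp_all add: sin_double cos_double_sin)
    have "cos a = 1 \<or> cos a = -1"
      using sin sin_cos_squared_add[of a] by (simp add: power2_eq_1_iff)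
    then show ?thesis
    proof
      assume c: "cos a = 1"
      then obtain n :: int where n: "a = n * (2 * pi)"
        by (auto simp: cos_one_2pi_int mult.assoc)
      have "\<gamma> (\<theta> + a) = g0" "deriv \<gamma> (\<theta> + a) = g1"
        unfolding n g0_def g1_def by (rule g.plus_of_int g'.plus_of_int)+
      then show ?thesis
        using sin s2 c by (simp add: F_def F'_def Q_def Q'_def power2_eq_square algebra_simps)
    next
      assume c: "cos a = -1"
      then have "cos (a + pi) = 1" by simp
      then obtain n :: int where "a + pi = n * (2 * pi)"
        unfolding cos_one_2pi_int by (auto simp: mult.assoc)
      then have n: "\<theta> + a = (\<theta> - pi) + n * (2 * pi)" by simp
      define e where "e = (\<lambda>x. 3 * \<gamma> x - \<gamma> (x - pi))"
      define p0 where "p0 = \<gamma> (\<theta> - pi)"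
      define p1 where "p1 = deriv \<gamma> (\<theta> - pi)"
      have p: "\<gamma> (\<theta> + a) = p0" "deriv \<gamma> (\<theta> + a) = p1"
        unfolding n p0_def p1_def by (rule g.plus_of_int g'.plus_of_int)+
      have p0: "0 < p0" "p0 \<le> 3 * g0" using pos three[of \<theta>] by (simp_all add: p0_def g0_def)
      have Fa: "F a = (3 * g0 - p0) * (g0 + p0)"
        using sin s2 c p by (simp add: F_def Q_def power2_eq_square algebra_simps)
      have "F' a = 0" if "F a = 0"
      proof -
        have eq: "p0 = 3 * g0" using that Fa g0 p0 by simp
        have de: "(e has_real_derivative 3 * g1 - p1) (at \<theta>)"
        proof -
          have "((\<lambda>x. \<gamma> (x + - pi)) has_real_derivative p1) (at \<theta>)"
            using dg[of "\<theta> - pi"] DERIV_shift[of \<gamma> p1 \<theta> "- pi"] by (simp add: p1_def)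
          then show ?thesis unfolding e_def g1_def
            by (auto intro!: derivative_eq_intros dg)
        qed
        have "e \<theta> = 0" using eq by (simp add: e_def p0_def g0_def)
        \<comment> \<open>The nonnegative function \<open>e\<close> vanishes at \<open>\<theta>\<close>, hence has a minimum there.\<close>
        then have "3 * g1 - p1 = 0"
          using three by (intro DERIV_local_min[OF de, of 1]) (auto simp: e_def)
        then show ?thesis
          using sin s2 c p eq by (simp add: F'_def Q_def Q'_def algebra_simps)
      qed
      then show ?thesis using Fa g0 p0 by simp
    qed
  qed
  have "\<exists>C\<ge>0. \<forall>x\<in>{0..2 * pi}. - C * (sin x)\<^sup>2 \<le> F x"
    by (rule lower_bound_by_sin_squared[OF dF dF']) (use zero in auto)
  then obtain C where C: "0 \<le> C" "\<And>x. x \<in> {0..2 * pi} \<Longrightarrow> - C * (sin x)\<^sup>2 \<le> F x"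
    by blast
  have FC: "- C * (sin d)\<^sup>2 \<le> F d" for d
  proof -
    define n where "n = \<lfloor>d / (2 * pi)\<rfloor>"
    define x where "x = d - n * (2 * pi)"
    have d: "d = x + n * (2 * pi)" by (simp add: x_def)
    have "n \<le> d / (2 * pi)" "d / (2 * pi) \<le> n + 1" unfolding n_def by linarith+
    then have x: "x \<in> {0..2 * pi}" by (simp add: x_def field_simps)
    have s: "sin d = sin x" "cos d = cos x" 
      using sin.plus_of_int[of x n] cos.plus_of_int[of x n] by (simp_all add: d)
    moreover have "\<gamma> (\<theta> + d) = \<gamma> (\<theta> + x)"
      unfolding d add.assoc[symmetric] by (rule g.plus_of_int)
    ultimately have "F d = F x" by (simp add: F_def Q_def sin_double)
    then show ?thesis using C(2)[OF x] s by simp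
  qed
  have "(Q d)\<^sup>2 \<le> 4 * g0 * (g0 + g1 * sin (2 * d) + (C / (4 * g0)) * (sin d)\<^sup>2)" for d
    using FC[of d] g0 by (simp add: F_def algebra_simps)
  then have "stabilizes \<gamma> \<theta> (C / (4 * g0))"
    using C(1) g0 by (simp add: stabilizes_def Q_def g0_def g1_def)
  then show ?thesis by blast
qed

text \<open>
  The choice depends on \<open>\<theta>\<close> only through the predicate \<open>stabilizes \<gamma> \<theta>\<close>, which is the same for
  \<open>\<theta>\<close> and \<open>\<theta> + 2 * pi\<close>; this makes an arbitrary choice periodic.
\<close>

definition stabilizer :: "(real \<Rightarrow> real) \<Rightarrow> real \<Rightarrow> real" where
  "stabilizer \<gamma> \<theta> = (SOME \<kappa>. stabilizes \<gamma> \<theta> \<kappa>)"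

lemma periodic_stabilizer:
  assumes "periodic_fun_simple \<gamma> (2 * pi)"
  shows "periodic_fun_simple (stabilizer \<gamma>) (2 * pi)"
proof
  fix \<theta>
  interpret g: periodic_fun_simple \<gamma> "2 * pi" by fact
  interpret g': periodic_fun_simple "deriv \<gamma>" "2 * pi" by (rule periodic_deriv[OF assms])
  have "\<gamma> (\<theta> + 2 * pi + d) = \<gamma> (\<theta> + d)" for d
    using g.plus_period[of "\<theta> + d"] by (simp add: algebra_simps)
  then have "stabilizes \<gamma> (\<theta> + 2 * pi) = stabilizes \<gamma> \<theta>"
    by (simp add: fun_eq_iff stabilizes_def g.plus_period g'.plus_period)
  then show "stabilizer \<gamma> (\<theta> + 2 * pi) = stabilizer \<gamma> \<theta>"
    by (simp add: stabilizer_def)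
qed

lemma stabilizes_mono:
  assumes "stabilizes \<gamma> \<theta> \<kappa>" "\<kappa> \<le> \<kappa>'" "0 < \<gamma> \<theta>"
  shows "stabilizes \<gamma> \<theta> \<kappa>'"
proof -
  have "4 * \<gamma> \<theta> * (\<gamma> \<theta> + deriv \<gamma> \<theta> * sin (2 * d) + \<kappa> * (sin d)\<^sup>2)
      \<le> 4 * \<gamma> \<theta> * (\<gamma> \<theta> + deriv \<gamma> \<theta> * sin (2 * d) + \<kappa>' * (sin d)\<^sup>2)" for d
    using assms by (intro mult_left_mono add_left_mono mult_right_mono) auto
  then show ?thesis using assms unfolding stabilizes_def by (meson order_trans)
qed

section \<open>The energy estimate on one segment\<close>

lemma dir_angle_polar:
  "v = norm v *\<^sub>R (vector [cos (dir_angle v), sin (dir_angle v)] :: real^2)"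
proof -
  have "\<exists>\<theta>. v = norm v *\<^sub>R (vector [cos \<theta>, sin \<theta>] :: real^2)"
  proof (cases "v = 0")
    case False
    have n: "(norm v)\<^sup>2 = (v $ 1)\<^sup>2 + (v $ 2)\<^sup>2"
      by (simp add: norm_vec_def L2_set_def sum_2)
    have "(v $ 1 / norm v)\<^sup>2 + (v $ 2 / norm v)\<^sup>2 = 1"
      using False by (simp add: power_divide n[symmetric] flip: add_divide_distrib)
    then obtain \<theta> where "v $ 1 / norm v = cos \<theta>" "v $ 2 / norm v = sin \<theta>"
      by (rule sincos_total_2pi)
    then have "v $ 1 = norm v * cos \<theta>" "v $ 2 = norm v * sin \<theta>"
      using False by (metis nonzero_mult_div_cancel_left norm_eq_zero times_divide_eq_right)+
    then have "v = norm v *\<^sub>R (vector [cos \<theta>, sin \<theta>] :: real^2)"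
      unfolding vec_eq_iff forall_2 by simp
    then show ?thesis by blast
  qed simp
  then show ?thesis unfolding dir_angle_def by (rule someI_ex)
qed

lemma inner_2: "(u :: real^2) \<bullet> v = u $ 1 * v $ 1 + u $ 2 * v $ 2"
  by (simp add: inner_vec_def sum_2)

text \<open>
  Up to the scalar part \<open>\<gamma> \<theta>\<close>, the matrix is \<open>deriv \<gamma> \<theta>\<close> times a reflection plus \<open>k \<theta>\<close> times the
  projection onto the normal of direction \<open>\<theta>\<close>; these produce the two sine terms.
\<close>

lemma Z_mat_bilinear:
  fixes t :: "real \<Rightarrow> real^2"
  defines "t \<equiv> \<lambda>\<theta>. vector [cos \<theta>, sin \<theta>]"
  shows "(Z_mat \<gamma> k \<theta> *v t \<alpha>) \<bullet> t \<beta> =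
    \<gamma> \<theta> * cos (\<alpha> - \<beta>) + deriv \<gamma> \<theta> * sin ((\<alpha> - \<theta>) + (\<beta> - \<theta>))
      + k \<theta> * (sin (\<alpha> - \<theta>) * sin (\<beta> - \<theta>))"
proof -
  have "sin ((\<alpha> - \<theta>) + (\<beta> - \<theta>)) = sin ((\<alpha> + \<beta>) - 2 * \<theta>)" by (simp add: algebra_simps)
  also have "\<dots> = (sin \<alpha> * cos \<beta> + cos \<alpha> * sin \<beta>) * cos (2 * \<theta>)
      - (cos \<alpha> * cos \<beta> - sin \<alpha> * sin \<beta>) * sin (2 * \<theta>)"
    by (simp only: sin_diff sin_add cos_add)
  finally have s: "sin ((\<alpha> - \<theta>) + (\<beta> - \<theta>)) = \<dots>" .
  have "(Z_mat \<gamma> k \<theta> *v t \<alpha>) $ 1 =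
      (\<gamma> \<theta> - deriv \<gamma> \<theta> * sin (2 * \<theta>) + k \<theta> * (sin \<theta>)\<^sup>2) * cos \<alpha>
      + (deriv \<gamma> \<theta> * cos (2 * \<theta>) - k \<theta> * (cos \<theta> * sin \<theta>)) * sin \<alpha>"
    "(Z_mat \<gamma> k \<theta> *v t \<alpha>) $ 2 =
      (deriv \<gamma> \<theta> * cos (2 * \<theta>) - k \<theta> * (cos \<theta> * sin \<theta>)) * cos \<alpha>
      + (\<gamma> \<theta> + deriv \<gamma> \<theta> * sin (2 * \<theta>) + k \<theta> * (cos \<theta>)\<^sup>2) * sin \<alpha>"
    by (simp_all add: Z_mat_def t_def matrix_vector_mult_def sum_2)
  moreover have "((g - g' * S + \<kappa> * s\<^sup>2) * x + (g' * C - \<kappa> * (c * s)) * y) * z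
      + ((g' * C - \<kappa> * (c * s)) * x + (g + g' * S + \<kappa> * c\<^sup>2) * y) * w
    = g * (x * z + y * w) + g' * ((y * z + x * w) * C - (x * z - y * w) * S)
      + \<kappa> * ((y * c - x * s) * (w * c - z * s))"
    for g g' S C \<kappa> c s x y z w :: real
    by algebra
  ultimately show ?thesis
    unfolding s inner_2 cos_diff sin_diff by (simp only: t_def vector_2)
qed

text \<open>
  The square is completed after multiplication by \<open>4 * g\<close> rather than \<open>4 * p\<close>, which covers the
  degenerate case \<open>p = 0\<close> without a separate argument.
\<close>

lemma quadratic_nonneg:
  fixes p q g r :: real
  assumes "q\<^sup>2 \<le> 4 * g * p" "0 < g"
  shows "0 \<le> p * r\<^sup>2 - q * r + g"
proof -
  have "0 \<le> (2 * g - q * r)\<^sup>2" by simp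
  also have "\<dots> = 4 * g * (g - q * r) + q\<^sup>2 * r\<^sup>2" by (simp add: power2_eq_square algebra_simps)
  also have "\<dots> \<le> 4 * g * (g - q * r) + (4 * g * p) * r\<^sup>2"
    using assms(1) by (intro add_left_mono mult_right_mono) auto
  also have "\<dots> = 4 * g * (p * r\<^sup>2 - q * r + g)" by (simp add: algebra_simps)
  finally show ?thesis using assms(2) by (simp add: zero_le_mult_iff)
qed

text \<open>
  In polar form \<open>v = a t(\<theta>)\<close> and \<open>w = b t(\<theta> + d)\<close>, the difference of the two sides is \<open>a\<close> times the
  quadratic at \<open>r = b / a\<close> whose discriminant \<open>stabilizes\<close> controls.
\<close>

lemma segment_energy_estimate:
  fixes v w :: "real^2"
  defines "\<theta> \<equiv> dir_angle v"
  assumes stab: "stabilizes \<gamma> \<theta> (k \<theta>)" and pos: "0 < \<gamma> \<theta>" and v: "v \<noteq> 0"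
  shows "\<gamma> (dir_angle w) * norm w - \<gamma> \<theta> * norm v
    \<le> (Z_mat \<gamma> k \<theta> *v w) \<bullet> (w - v) / norm v"
proof -
  define t :: "real \<Rightarrow> real^2" where "t = (\<lambda>\<theta>. vector [cos \<theta>, sin \<theta>])"
  define d where "d = dir_angle w - \<theta>"
  define a where "a = norm v"
  define b where "b = norm w"
  define p where "p = \<gamma> \<theta> + deriv \<gamma> \<theta> * sin (2 * d) + k \<theta> * (sin d)\<^sup>2"
  define q where "q = \<gamma> \<theta> * cos d + deriv \<gamma> \<theta> * sin d"
  have a: "0 < a" using v by (simp add: a_def)
  have vt: "v = a *\<^sub>R t \<theta>"
    unfolding t_def a_def \<theta>_def by (rule dir_angle_polar)
  have \<theta>d: "\<theta> + d = dir_angle w" by (simp add: d_def)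
  have wt: "w = b *\<^sub>R t (\<theta> + d)"
    unfolding t_def b_def \<theta>d by (rule dir_angle_polar)
  have zz: "(Z_mat \<gamma> k \<theta> *v t (\<theta> + d)) \<bullet> t (\<theta> + d) = p" "(Z_mat \<gamma> k \<theta> *v t (\<theta> + d)) \<bullet> t \<theta> = q"
    unfolding t_def Z_mat_bilinear by (simp_all add: p_def q_def power2_eq_square)
  have "(Z_mat \<gamma> k \<theta> *v w) \<bullet> (w - v) = p * b\<^sup>2 - q * (a * b)"
    unfolding vt wt
    by (simp add: matrix_vector_mult_scaleR inner_diff_right zz power2_eq_square algebra_simps)
  moreover have "\<gamma> (\<theta> + d) * b - \<gamma> \<theta> * a \<le> (p * b\<^sup>2 - q * (a * b)) / a"
  proof -
    have "0 \<le> p * (b / a)\<^sup>2 - (q + \<gamma> (\<theta> + d)) * (b / a) + \<gamma> \<theta>"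
      using stab pos unfolding stabilizes_def p_def q_def by (intro quadratic_nonneg) auto
    then have "0 \<le> (p * (b / a)\<^sup>2 - (q + \<gamma> (\<theta> + d)) * (b / a) + \<gamma> \<theta>) * a"
      using a by simp
    also have "\<dots> = (p * b\<^sup>2 - q * (a * b)) / a - (\<gamma> (\<theta> + d) * b - \<gamma> \<theta> * a)"
      using a by (simp add: divide_simps) (simp add: power2_eq_square algebra_simps)
    finally show ?thesis by linarith
  qed
  ultimately show ?thesis by (simp only: a_def b_def \<theta>d)
qed

section \<open>Mass-lumped products as sums over the elements\<close>

text \<open>
  Here \<open>l j\<close> and \<open>r j\<close> are the limits at the left and right end of the \<open>j\<close>-th element, taken from
  inside it.
\<close>

definition element_limits ::
    "nat \<Rightarrow> (real \<Rightarrow> 'a::topological_space) \<Rightarrow> (nat \<Rightarrow> 'a) \<Rightarrow> (nat \<Rightarrow> 'a) \<Rightarrow> bool" where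
  "element_limits N f l r \<longleftrightarrow> (\<forall>j\<in>{1..N}.
     (f \<longlongrightarrow> l j) (at_right (node N (j - 1))) \<and> (f \<longlongrightarrow> r j) (at_left (node N j)))"

lemma lumped_eq_sum:
  assumes "element_limits N f fl fr" "element_limits N g gl gr"
  shows "lumped N X f g =
    (\<Sum>j=1..N. norm (seg N X j) / 2 * (fr j \<bullet> gr j + fl j \<bullet> gl j))"
proof -
  have "Lim (at_right (node N (j - 1))) f = fl j" "Lim (at_left (node N j)) f = fr j"
    "Lim (at_right (node N (j - 1))) g = gl j" "Lim (at_left (node N j)) g = gr j"
    if "j \<in> {1..N}" for j
    using assms that unfolding element_limits_def by (auto intro!: tendsto_Lim)
  then show ?thesis unfolding lumped_def by (intro sum.cong) auto
qed

lemma element_limits_inner: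
  assumes "element_limits N f fl fr" "element_limits N g gl gr"
  shows "element_limits N (\<lambda>\<rho>. f \<rho> \<bullet> g \<rho>) (\<lambda>j. fl j \<bullet> gl j) (\<lambda>j. fr j \<bullet> gr j)"
  using assms unfolding element_limits_def by (auto intro!: tendsto_intros)

lemma element_limits_scaleR:
  fixes g :: "real \<Rightarrow> 'a::real_normed_vector"
  assumes "element_limits N f fl fr" "element_limits N g gl gr"
  shows "element_limits N (\<lambda>\<rho>. f \<rho> *\<^sub>R g \<rho>) (\<lambda>j. fl j *\<^sub>R gl j) (\<lambda>j. fr j *\<^sub>R gr j)"
  using assms unfolding element_limits_def by (auto intro!: tendsto_intros)

lemma elem_idx_eq:
  assumes "j \<in> {1..N}" "node N (j - 1) < \<rho>" "\<rho> \<le> node N j"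
  shows "elem_idx N \<rho> = j"
proof -
  have "real (j - 1) < \<rho> * real N" "\<rho> * real N \<le> real j"
    using assms by (auto simp: node_def field_simps)
  then have "\<lceil>\<rho> * real N\<rceil> = int j"
    using assms(1) by (intro ceiling_unique) (auto simp: of_nat_diff)
  then show ?thesis by (simp add: elem_idx_def)
qed

lemma node_less: "j \<in> {1..N} \<Longrightarrow> node N (j - 1) < node N j"
  by (simp add: node_def divide_strict_right_mono)

lemma node_bounds: "j \<in> {1..N} \<Longrightarrow> 0 \<le> node N (j - 1) \<and> node N j \<le> 1"
  by (simp add: node_def)

text \<open>
  The value that \<open>elem_idx\<close> assigns to a node itself is invisible to the one-sided limits, so a
  function that is constant on each element has that constant as limit at both ends.
\<close>

lemma element_limits_const: "element_limits N (\<lambda>\<rho>. c (elem_idx N \<rho>)) c c"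
  unfolding element_limits_def
proof (intro ballI conjI)
  fix j assume j: "j \<in> {1..N}"
  have "\<forall>\<^sub>F \<rho> in at_right (node N (j - 1)). c (elem_idx N \<rho>) = c j"
    unfolding eventually_at_right_field using node_less[OF j] elem_idx_eq[OF j] less_imp_le by metis
  then show "((\<lambda>\<rho>. c (elem_idx N \<rho>)) \<longlongrightarrow> c j) (at_right (node N (j - 1)))"
    by (rule tendsto_eventually)
  have "\<forall>\<^sub>F \<rho> in at_left (node N j). c (elem_idx N \<rho>) = c j"
    unfolding eventually_at_left_field using node_less[OF j] elem_idx_eq[OF j] less_imp_le by metis
  then show "((\<lambda>\<rho>. c (elem_idx N \<rho>)) \<longlongrightarrow> c j) (at_left (node N j))"
    by (rule tendsto_eventually)
qed

lemma element_limits_continuous: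
  assumes "continuous_on {0..1} u"
  shows "element_limits N u (\<lambda>j. u (node N (j - 1))) (\<lambda>j. u (node N j))"
  unfolding element_limits_def
proof (intro ballI conjI)
  fix j assume j: "j \<in> {1..N}"
  have c: "continuous_on {node N (j - 1)..node N j} u"
    using node_bounds[OF j] by (intro continuous_on_subset[OF assms]) auto
  from c show "(u \<longlongrightarrow> u (node N (j - 1))) (at_right (node N (j - 1)))"
    by (rule continuous_on_Icc_at_rightD) (rule node_less[OF j])
  from c show "(u \<longlongrightarrow> u (node N j)) (at_left (node N j))"
    by (rule continuous_on_Icc_at_leftD) (rule node_less[OF j])
qed

lemma fe_space_diff:
  assumes "u \<in> fe_space N" "v \<in> fe_space N"
  shows "(\<lambda>\<rho>. u \<rho> - v \<rho>) \<in> fe_space N"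
  unfolding fe_space_def
proof (intro CollectI conjI ballI)
  show "continuous_on {0..1} (\<lambda>\<rho>. u \<rho> - v \<rho>)" "u 0 - v 0 = u 1 - v 1"
    using assms by (auto simp: fe_space_def intro!: continuous_intros)
  fix j assume j: "j \<in> {1..N}"
  obtain a b where ab: "\<forall>\<rho>\<in>{node N (j - 1)..node N j}. u \<rho> = a + b * \<rho>"
    using assms(1) j unfolding fe_space_def by blast
  obtain c d where cd: "\<forall>\<rho>\<in>{node N (j - 1)..node N j}. v \<rho> = c + d * \<rho>"
    using assms(2) j unfolding fe_space_def by blast
  show "\<exists>a b. \<forall>\<rho>\<in>{node N (j - 1)..node N j}. u \<rho> - v \<rho> = a + b * \<rho>"
    by (rule exI[of _ "a - c"], rule exI[of _ "b - d"]) (use ab cd in \<open>auto simp: algebra_simps\<close>)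
qed

lemma const_in_fe_space: "(\<lambda>\<rho>. c) \<in> fe_space N"
proof -
  have "\<exists>a b. \<forall>\<rho>\<in>S. c = a + b * \<rho>" for S :: "real set"
    by (rule exI[of _ c], rule exI[of _ 0]) simp
  then show ?thesis by (simp add: fe_space_def)
qed

lemma fe_space2_continuous:
  assumes "X \<in> fe_space2 N"
  shows "continuous_on {0..1} X"
proof -
  have "continuous_on {0..1} (\<lambda>\<rho>. \<chi> i. X \<rho> $ i)"
    using assms by (intro continuous_on_vec_lambda) (auto simp: fe_space2_def fe_space_def)
  then show ?thesis by simp
qed

lemma fe_space2_diff:
  "X \<in> fe_space2 N \<Longrightarrow> Y \<in> fe_space2 N \<Longrightarrow> (\<lambda>\<rho>. X \<rho> - Y \<rho>) \<in> fe_space2 N"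
  unfolding fe_space2_def by (simp add: fe_space_diff)

lemma fe_space2_closed: "X \<in> fe_space2 N \<Longrightarrow> X 0 = X 1"
  by (simp add: fe_space2_def fe_space_def vec_eq_iff)

section \<open>One step of the scheme\<close>

lemma telescope_closed:
  fixes f :: "nat \<Rightarrow> real"
  assumes "f N = f 0"
  shows "(\<Sum>j=1..N. f j - f (j - 1)) = 0"
proof -
  have "(\<Sum>j=1..n. f j - f (j - 1)) = f n - f 0" for n
    by (induction n) auto
  then show ?thesis using assms by simp
qed

text \<open>The constant value of \<open>half_normal\<close> inside the \<open>j\<close>-th element.\<close>

definition elem_normal :: "nat \<Rightarrow> (real \<Rightarrow> real^2) \<Rightarrow> (real \<Rightarrow> real^2) \<Rightarrow> nat \<Rightarrow> real^2" where
  "elem_normal N X X' j = - ((1 / 2) *\<^sub>R perp ((seg N X j + seg N X' j) /\<^sub>R norm (seg N X j)))"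

lemma element_limits_half_normal:
  "element_limits N (half_normal N X X') (elem_normal N X X') (elem_normal N X X')"
proof -
  have "half_normal N X X' = (\<lambda>\<rho>. elem_normal N X X' (elem_idx N \<rho>))"
    by (simp add: fun_eq_iff half_normal_def elem_normal_def arc_deriv_def seg_def Let_def
        scaleR_right_distrib)
  then show ?thesis by (simp add: element_limits_const)
qed

lemma element_limits_arc_deriv:
  fixes f :: "real \<Rightarrow> 'a::real_normed_vector" and N X
  defines "d \<equiv> \<lambda>j. (f (node N j) - f (node N (j - 1))) /\<^sub>R norm (seg N X j)"
  shows "element_limits N (arc_deriv N X f) d d"
proof -
  have "arc_deriv N X f = (\<lambda>\<rho>. d (elem_idx N \<rho>))"
    by (simp add: fun_eq_iff arc_deriv_def d_def Let_def)
  then show ?thesis by (simp add: element_limits_const)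
qed

text \<open>
  Multiplied by the old length, the averaged normal is \<open>- (1/2)\<close> times the rotated sum of the old and
  new segments, so the left side is quadratic in the sum and the difference of the two curves.
  Summation by parts, whose boundary term \<open>w\<close> vanishes for closed curves, moves the
  increment along the curve from the \<open>y\<close>-coordinates to the \<open>x\<close>-coordinates; what remains are mixed
  products of sums and differences of the two curves, which collapse to the difference of the two shoelace formulas.
\<close>

lemma area_difference:
  assumes X: "X \<in> fe_space2 N" and X': "X' \<in> fe_space2 N" and "0 < N"
    and ne: "\<And>j. j \<in> {1..N} \<Longrightarrow> seg N X j \<noteq> 0"
  defines "V \<equiv> \<lambda>j. X' (node N j) - X (node N j)"
  shows "(\<Sum>j=1..N. norm (seg N X j) / 2 *
      (elem_normal N X X' j \<bullet> V j + elem_normal N X X' j \<bullet> V (j - 1))) = area N X' - area N X"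
proof -
  define w where "w = (\<lambda>j. - (1 / 2) * (X' (node N j) $ 2 + X (node N j) $ 2)
      * (X' (node N j) $ 1 - X (node N j) $ 1))"
  let ?a = "\<lambda>Y j. (Y (node N j) $ 1 - Y (node N (j - 1)) $ 1) *
      ((Y (node N j) $ 2 + Y (node N (j - 1)) $ 2 :: real))"
  have "node N N = 1" "node N 0 = 0" using \<open>0 < N\<close> by (simp_all add: node_def)
  then have "w N = w 0" using fe_space2_closed[OF X] fe_space2_closed[OF X'] by (simp add: w_def)
  then have w0: "(\<Sum>j=1..N. w j - w (j - 1)) = 0" by (rule telescope_closed)
  have "norm (seg N X j) / 2 *
      (elem_normal N X X' j \<bullet> V j + elem_normal N X X' j \<bullet> V (j - 1))
     = 1 / 2 * ?a X' j - 1 / 2 * ?a X j + (w j - w (j - 1))" if "j \<in> {1..N}" for j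
  proof -
    let ?s = "seg N X j + seg N X' j"
    have normal: "norm (seg N X j) *\<^sub>R elem_normal N X X' j = - ((1 / 2) *\<^sub>R perp ?s)"
      using ne[OF that] by (simp add: elem_normal_def perp_def vec_eq_iff forall_2 field_simps)
    have "norm (seg N X j) / 2 *
      (elem_normal N X X' j \<bullet> V j + elem_normal N X X' j \<bullet> V (j - 1))
      = 1 / 2 * ((norm (seg N X j) *\<^sub>R elem_normal N X X' j) \<bullet> (V j + V (j - 1)))"
      by (simp add: inner_add_right distrib_left)
    also have "\<dots> = - (1 / 4) * (perp ?s \<bullet> (V j + V (j - 1)))"
      unfolding normal by simp
    also have "\<dots> = 1 / 2 * ?a X' j - 1 / 2 * ?a X j + (w j - w (j - 1))"
      by (simp add: perp_def inner_2 V_def w_def seg_def field_simps)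
    finally show ?thesis .
  qed
  then have "(\<Sum>j=1..N. norm (seg N X j) / 2 *
      (elem_normal N X X' j \<bullet> V j + elem_normal N X X' j \<bullet> V (j - 1)))
     = (\<Sum>j=1..N. 1 / 2 * ?a X' j - 1 / 2 * ?a X j + (w j - w (j - 1)))"
    by (intro sum.cong) auto
  also have "\<dots> = area N X' - area N X"
    unfolding area_def sum.distrib sum_subtractf w0[unfolded sum_subtractf] sum_distrib_left[symmetric]
    by simp
  finally show ?thesis .
qed

text \<open>The constant test function has vanishing arc derivative, which leaves only the flux term.\<close>

lemma SP_step_area:
  assumes X: "X \<in> fe_space2 N" and X': "X' \<in> fe_space2 N" and "0 < N" and "0 < \<tau>"
    and ne: "\<And>j. j \<in> {1..N} \<Longrightarrow> seg N X j \<noteq> 0"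
    and step: "SP_step \<gamma> k N \<tau> X X' \<mu>"
  shows "area N X' = area N X"
proof -
  define V where "V = (\<lambda>j. X' (node N j) - X (node N j))"
  define n where "n = elem_normal N X X'"
  have V: "element_limits N (\<lambda>\<rho>. (X' \<rho> - X \<rho>) /\<^sub>R \<tau>)
      (\<lambda>j. V (j - 1) /\<^sub>R \<tau>) (\<lambda>j. V j /\<^sub>R \<tau>)"
    unfolding V_def
    by (intro element_limits_continuous continuous_intros fe_space2_continuous[OF X] fe_space2_continuous[OF X'])
  have one: "element_limits N (\<lambda>\<rho>. 1 :: real) (\<lambda>j. 1) (\<lambda>j. 1)"
    by (simp add: element_limits_def)
  have "arc_deriv N X (\<lambda>\<rho>. 1 :: real) = (\<lambda>\<rho>. 0)"
    by (simp add: fun_eq_iff arc_deriv_def Let_def)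
  then have d0: "lumped N X (arc_deriv N X \<mu>) (arc_deriv N X (\<lambda>\<rho>. 1)) = 0"
    using lumped_eq_sum[OF element_limits_arc_deriv[of N X \<mu>] element_limits_arc_deriv[of N X "\<lambda>\<rho>. 1"]]
    by simp
  have "lumped N X (\<lambda>\<rho>. half_normal N X X' \<rho> \<bullet> ((X' \<rho> - X \<rho>) /\<^sub>R \<tau>)) (\<lambda>\<rho>. 1) = 0"
    using step const_in_fe_space[of 1 N] d0 unfolding SP_step_def by force
  then have "0 = (\<Sum>j=1..N. norm (seg N X j) / 2 * (n j \<bullet> (V j /\<^sub>R \<tau>) + n j \<bullet> (V (j - 1) /\<^sub>R \<tau>)))"
    unfolding lumped_eq_sum[OF element_limits_inner[OF element_limits_half_normal V] one]
    by (simp add: n_def)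
  also have "\<dots> = inverse \<tau> *
      (\<Sum>j=1..N. norm (seg N X j) / 2 * (n j \<bullet> V j + n j \<bullet> V (j - 1)))"
    by (simp add: sum_distrib_left algebra_simps)
  also have "\<dots> = inverse \<tau> * (area N X' - area N X)"
    unfolding n_def V_def using area_difference[OF X X' \<open>0 < N\<close> ne] by simp
  finally show ?thesis using \<open>0 < \<tau>\<close> by simp
qed

text \<open>
  The test functions are \<open>\<mu>\<close> and \<open>V = X' - X\<close>.  They turn both equations into statements about the
  same number \<open>T = (\<mu> n, V)\<close>, which the first forces to be nonpositive by the dissipation term and
  the second equates with the sum that dominates the energy increment.
\<close>

lemma SP_step_energy:
  assumes X: "X \<in> fe_space2 N" and X': "X' \<in> fe_space2 N" and \<mu>: "\<mu> \<in> fe_space N" and "0 < \<tau>"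
    and ne: "\<And>j. j \<in> {1..N} \<Longrightarrow> seg N X j \<noteq> 0"
    and step: "SP_step \<gamma> k N \<tau> X X' \<mu>"
    and pos: "\<And>\<theta>. 0 < \<gamma> \<theta>" and stab: "\<And>\<theta>. stabilizes \<gamma> \<theta> (k \<theta>)"
  shows "energy \<gamma> N X' \<le> energy \<gamma> N X"
proof -
  define V where "V = (\<lambda>\<rho>. X' \<rho> - X \<rho>)"
  define n where "n = elem_normal N X X'"
  define a where "a = (\<lambda>j. norm (seg N X j))"
  define Z where "Z = (\<lambda>j. Z_mat \<gamma> k (dir_angle (seg N X j)))"
  define T where "T = (\<Sum>j=1..N. a j / 2 * (n j \<bullet> V (node N j) * \<mu> (node N j)
      + n j \<bullet> V (node N (j - 1)) * \<mu> (node N (j - 1))))"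
  have V_fe: "V \<in> fe_space2 N" unfolding V_def by (rule fe_space2_diff[OF X' X])
  note V = element_limits_continuous[OF fe_space2_continuous[OF V_fe]]
  have V\<tau>: "element_limits N (\<lambda>\<rho>. V \<rho> /\<^sub>R \<tau>)
      (\<lambda>j. V (node N (j - 1)) /\<^sub>R \<tau>) (\<lambda>j. V (node N j) /\<^sub>R \<tau>)"
    by (intro element_limits_continuous continuous_intros fe_space2_continuous[OF V_fe])
  have "continuous_on {0..1} \<mu>" using \<mu> by (simp add: fe_space_def)
  note \<mu>_lim = element_limits_continuous[OF this]
  note n = element_limits_half_normal[of N X X', folded n_def]

  have diss: "0 \<le> lumped N X (arc_deriv N X \<mu>) (arc_deriv N X \<mu>)"
    unfolding lumped_eq_sum[OF element_limits_arc_deriv element_limits_arc_deriv]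
    by (intro sum_nonneg mult_nonneg_nonneg add_nonneg_nonneg) auto
  have "lumped N X (\<lambda>\<rho>. half_normal N X X' \<rho> \<bullet> (V \<rho> /\<^sub>R \<tau>)) \<mu>
      + lumped N X (arc_deriv N X \<mu>) (arc_deriv N X \<mu>) = 0"
    using step \<mu> by (simp add: SP_step_def V_def)
  moreover have "lumped N X (\<lambda>\<rho>. half_normal N X X' \<rho> \<bullet> (V \<rho> /\<^sub>R \<tau>)) \<mu> = inverse \<tau> * T"
    unfolding lumped_eq_sum[OF element_limits_inner[OF n V\<tau>] \<mu>_lim] T_def a_def
    by (simp add: sum_distrib_left algebra_simps)
  ultimately have "inverse \<tau> * T \<le> 0" using diss by linarith
  then have T: "T \<le> 0" using \<open>0 < \<tau>\<close> by (simp add: mult_le_0_iff)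

  have Z_lim: "element_limits N (\<lambda>\<rho>. Z_mat \<gamma> k (curve_angle N X \<rho>) *v arc_deriv N X X' \<rho>)
      (\<lambda>j. Z j *v (seg N X' j /\<^sub>R a j)) (\<lambda>j. Z j *v (seg N X' j /\<^sub>R a j))"
  proof -
    have "(\<lambda>\<rho>. Z_mat \<gamma> k (curve_angle N X \<rho>) *v arc_deriv N X X' \<rho>)
      = (\<lambda>\<rho>. (\<lambda>j. Z j *v (seg N X' j /\<^sub>R a j)) (elem_idx N \<rho>))"
      by (simp add: Z_def a_def curve_angle_def arc_deriv_def seg_def Let_def)
    then show ?thesis using element_limits_const[of N "\<lambda>j. Z j *v (seg N X' j /\<^sub>R a j)"] by simp
  qed
  have "lumped N X (\<lambda>\<rho>. \<mu> \<rho> *\<^sub>R half_normal N X X' \<rho>) V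
      = lumped N X (\<lambda>\<rho>. Z_mat \<gamma> k (curve_angle N X \<rho>) *v arc_deriv N X X' \<rho>) (arc_deriv N X V)"
    using step V_fe by (simp add: SP_step_def)
  moreover have "lumped N X (\<lambda>\<rho>. \<mu> \<rho> *\<^sub>R half_normal N X X' \<rho>) V = T"
    unfolding lumped_eq_sum[OF element_limits_scaleR[OF \<mu>_lim n] V] T_def a_def
    by (simp add: algebra_simps)
  moreover have "lumped N X (\<lambda>\<rho>. Z_mat \<gamma> k (curve_angle N X \<rho>) *v arc_deriv N X X' \<rho>)
      (arc_deriv N X V) = (\<Sum>j=1..N. (Z j *v seg N X' j) \<bullet> (seg N X' j - seg N X j) / a j)"
    unfolding lumped_eq_sum[OF Z_lim element_limits_arc_deriv]
  proof (rule sum.cong)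
    fix j assume "j \<in> {1..N}"
    then have "a j > 0" using ne by (simp add: a_def)
    moreover have "V (node N j) - V (node N (j - 1)) = seg N X' j - seg N X j"
      by (simp add: V_def seg_def)
    moreover have "norm (seg N X j) = a j" by (simp add: a_def)
    ultimately show "norm (seg N X j) / 2 *
        ((Z j *v (seg N X' j /\<^sub>R a j)) \<bullet> ((V (node N j) - V (node N (j - 1))) /\<^sub>R norm (seg N X j)) +
         (Z j *v (seg N X' j /\<^sub>R a j)) \<bullet> ((V (node N j) - V (node N (j - 1))) /\<^sub>R norm (seg N X j)))
      = (Z j *v seg N X' j) \<bullet> (seg N X' j - seg N X j) / a j"
      by (simp add: matrix_vector_mult_scaleR divide_simps)
  qed simp
  ultimately have "(\<Sum>j=1..N. (Z j *v seg N X' j) \<bullet> (seg N X' j - seg N X j) / a j) \<le> 0"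
    using T by simp
  moreover have "energy \<gamma> N X' - energy \<gamma> N X
      \<le> (\<Sum>j=1..N. (Z j *v seg N X' j) \<bullet> (seg N X' j - seg N X j) / a j)"
    unfolding energy_def sum_subtractf[symmetric] Z_def a_def
    by (intro sum_mono segment_energy_estimate stab pos ne)
  ultimately show ?thesis by simp
qed

theorem theorem3p1:
  fixes \<gamma> :: "real \<Rightarrow> real"
  assumes "periodic_fun_simple \<gamma> (2 * pi)"
    and "\<And>\<theta>. 0 < \<gamma> \<theta>"
    and "C2_fun \<gamma>"
    and "\<And>\<theta>. 0 \<le> 3 * \<gamma> \<theta> - \<gamma> (\<theta> - pi)"
  shows "\<exists>K :: real \<Rightarrow> real. periodic_fun_simple K (2 * pi) \<and> (\<forall>\<theta>. 0 \<le> K \<theta>) \<and>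
    (\<forall>(k :: real \<Rightarrow> real) (N :: nat) (\<tau> :: real)
        (X :: nat \<Rightarrow> real \<Rightarrow> real^2) (\<mu> :: nat \<Rightarrow> real \<Rightarrow> real).
      periodic_fun_simple k (2 * pi) \<longrightarrow> (\<forall>\<theta>. 0 \<le> k \<theta>) \<longrightarrow> (\<forall>\<theta>. K \<theta> \<le> k \<theta>) \<longrightarrow>
      2 < N \<longrightarrow> 0 < \<tau> \<longrightarrow>
      solves_SP \<gamma> k N \<tau> X \<mu> \<longrightarrow>
      (\<forall>m. \<forall>j\<in>{1..N}. seg N (X m) j \<noteq> 0) \<longrightarrow>
      (\<forall>m. area N (X (Suc m)) = area N (X m) \<and> area N (X m) = area N (X 0)) \<and>
      (\<forall>m. energy \<gamma> N (X (Suc m)) \<le> energy \<gamma> N (X m) \<and>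
           energy \<gamma> N (X m) \<le> energy \<gamma> N (X 0)))"
proof -
  have K: "stabilizes \<gamma> \<theta> (stabilizer \<gamma> \<theta>)" for \<theta>
    unfolding stabilizer_def by (rule someI_ex) (rule stabilizes_exists[OF assms])
  show ?thesis
  proof (intro exI[of _ "stabilizer \<gamma>"] conjI allI impI)
    show "periodic_fun_simple (stabilizer \<gamma>) (2 * pi)"
      by (rule periodic_stabilizer[OF assms(1)])
    show "0 \<le> stabilizer \<gamma> \<theta>" for \<theta> using K by (simp add: stabilizes_def)
    fix k :: "real \<Rightarrow> real" and N :: nat and \<tau> :: real
      and X :: "nat \<Rightarrow> real \<Rightarrow> real^2" and \<mu> :: "nat \<Rightarrow> real \<Rightarrow> real" and m :: nat
    assume k: "\<forall>\<theta>. stabilizer \<gamma> \<theta> \<le> k \<theta>" and N: "2 < N" and \<tau>: "0 < \<tau>"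
      and sol: "solves_SP \<gamma> k N \<tau> X \<mu>" and ne: "\<forall>m. \<forall>j\<in>{1..N}. seg N (X m) j \<noteq> 0"
    have stab: "stabilizes \<gamma> \<theta> (k \<theta>)" for \<theta>
      using stabilizes_mono[OF K] k assms(2) by blast
    have X: "X m \<in> fe_space2 N" for m
      using sol unfolding solves_SP_def by (cases m) auto
    have \<mu>: "\<mu> (Suc m) \<in> fe_space N" and step: "SP_step \<gamma> k N \<tau> (X m) (X (Suc m)) (\<mu> (Suc m))" for m
      using sol unfolding solves_SP_def by auto
    have area: "area N (X (Suc m)) = area N (X m)" for m
      by (rule SP_step_area[OF X X _ \<tau> _ step]) (use N ne in auto)
    have energy: "energy \<gamma> N (X (Suc m)) \<le> energy \<gamma> N (X m)" for m
      by (rule SP_step_energy[OF X X \<mu> \<tau> _ step assms(2) stab]) (use ne in auto)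
    show "area N (X (Suc m)) = area N (X m)" "energy \<gamma> N (X (Suc m)) \<le> energy \<gamma> N (X m)"
      by (fact area energy)+
    show "area N (X m) = area N (X 0)" by (induction m) (simp_all add: area)
    show "energy \<gamma> N (X m) \<le> energy \<gamma> N (X 0)"
      by (induction m) (auto intro: order_trans[OF energy])
  qed
qed

end
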